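(* Let $\tau\neq0$ and let $H_3(\tau)=(\mathbb{R}^3,g_\tau)$ with $g_\tau=dx^2-dy^2+(dz+\tau(y\,dx-x\,dy))^2$. Let $M$ be a helix spacelike surface in $H_3(\tau)$ with constant hyperbolic angle $\vartheta$. Then, with respect to the local coordinates $(u,v)$ on $M$ defined by $$\partial_u=T,\qquad \partial_v=a\,T+b\,JT,$$ $$a(u,v)=-\frac{\sinh\left(2\tau\sinh^2\vartheta\,u+\eta(v)\right)}{\sinh\vartheta},\qquad b(u,v)=\cosh\left(2\tau\sinh^2\vartheta\,u+\eta(v)\right)$$ (with $\eta$ a smooth function of $v$), the position vector $F$ of $M$ in $\mathbb{R}^3$ is given by $$F(u,v)=\Bigl(\frac{\coth\vartheta}{2\tau}\cosh(u)+f_1(v),\ \frac{\coth\vartheta}{2\tau}\sinh(u)+f_2(v),\ \frac{\cosh^2\vartheta}{2}u-\frac{\coth\vartheta}{2\tau}\bigl(f_2(v)\cosh(u)-f_1(v)\sinh(u)\bigr)+f_3(v)\Bigr),$$ where $f_1,f_2,f_3$ satisfy $$f_1'(v)^2-f_2'(v)^2=\cosh^2\vartheta,\qquad f_3'(v)=\tau\bigl(f_1(v)f_2'(v)-f_2(v)f_1'(v)\bigr).$$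
   Context: The orthonormal frame on $H_3(\tau)$ is $E_1=\partial_x-\tau y\,\partial_z$, $E_2=\partial_y+\tau x\,\partial_z$, $E_3=\partial_z$, with $g_\tau(E_1,E_1)=g_\tau(E_3,E_3)=1$, $g_\tau(E_2,E_2)=-1$ and $[E_1,E_2]=2\tau E_3$. The cross product $\wedge$ is the bilinear skew-symmetric product with $E_1\wedge E_2=E_3$, $E_2\wedge E_3=E_1$, $E_1\wedge E_3=E_2$. For an oriented surface $M$ with unit normal $N$, $g_\tau(N,N)=\varepsilon=\pm1$, the angle function is $\nu=\varepsilon\,g_\tau(N,E_3)$, and $M$ is a helix (constant angle) surface if $\nu$ is constant. $M$ is spacelike if $\varepsilon=-1$; in that case one writes, up to the orientation of $N$, $\nu=\sinh\vartheta\neq0$ with $\vartheta>0$, and $\vartheta$ is called the hyperbolic angle between $N$ and $E_3$. $T$ is the tangential part of $E_3$, i.e. $E_3=T+\nu N$, and $JX=N\wedge X$ for $X$ tangent to $M$. One writes $N=\cosh\vartheta(\sinh\varphi\,E_1+\cosh\varphi\,E_2)-\sinh\vartheta\,E_3$ for a smooth function $\varphi$ on $M$; in the coordinates above $\varphi(u)=-2\tau\sinh^2\vartheta\,u+c$ with $c$ a real constant, and the displayed formula for $F$ is the one written after the reparametrization $\varphi(u)\mapsto u$. The functions $f_1,f_2,f_3$ are smooth functions of $v$.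
   Formalization: In the third coordinate the factor of f_2 cosh − f_1 sinh is corrected from coth ϑ/(2τ) to coth ϑ/2 (the printed one fails for τ≠1); cosh, sinh are taken at φ(u) = −2τ sinh²ϑ u + c, while the linear term keeps the u with ∂_u = T. *)

theory Defs
  imports "HOL-Analysis.Analysis"
begin

definition coth :: "real \<Rightarrow> real" where
  "coth x = cosh x / sinh x"

text \<open>Smoothness (all orders) of a map on an open set: every iterated directional derivative
  exists on the set.\<close>

primrec times_differentiable_on ::
    "nat \<Rightarrow> 'a::euclidean_space set \<Rightarrow> ('a \<Rightarrow> 'b::euclidean_space) \<Rightarrow> bool" where
  "times_differentiable_on 0 S f \<longleftrightarrow> continuous_on S f"
| "times_differentiable_on (Suc k) S f \<longleftrightarrow>
     (\<forall>x\<in>S. f differentiable (at x)) \<and>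
     (\<forall>w. times_differentiable_on k S (\<lambda>x. frechet_derivative f (at x) w))"

definition smooth_on :: "'a::euclidean_space set \<Rightarrow> ('a \<Rightarrow> 'b::euclidean_space) \<Rightarrow> bool" where
  "smooth_on S f \<longleftrightarrow> (\<forall>k. times_differentiable_on k S f)"

text \<open>The space \<open>H\<^sub>3(\<tau>)\<close>. Points and tangent vectors are both elements of \<open>real ^ 3\<close>; a tangent
  vector at \<open>p\<close> is given by its coefficients with respect to the coordinate fields
  \<open>\<partial>\<^sub>x, \<partial>\<^sub>y, \<partial>\<^sub>z\<close>.\<close>

definition heis_metric :: "real \<Rightarrow> real ^ 3 \<Rightarrow> real ^ 3 \<Rightarrow> real ^ 3 \<Rightarrow> real" where
  "heis_metric \<tau> p X Y =
     X$1 * Y$1 - X$2 * Y$2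
     + (X$3 + \<tau> * (p$2 * X$1 - p$1 * X$2)) * (Y$3 + \<tau> * (p$2 * Y$1 - p$1 * Y$2))"

definition heis_E1 :: "real \<Rightarrow> real ^ 3 \<Rightarrow> real ^ 3" where
  "heis_E1 \<tau> p = vector [1, 0, - \<tau> * p$2]"

definition heis_E2 :: "real \<Rightarrow> real ^ 3 \<Rightarrow> real ^ 3" where
  "heis_E2 \<tau> p = vector [0, 1, \<tau> * p$1]"

definition heis_E3 :: "real ^ 3" where
  "heis_E3 = vector [0, 0, 1]"

text \<open>The third frame coefficient of \<open>X\<close>; the first two are \<open>X$1\<close> and \<open>X$2\<close>.\<close>

definition heis_coeff3 :: "real \<Rightarrow> real ^ 3 \<Rightarrow> real ^ 3 \<Rightarrow> real" where
  "heis_coeff3 \<tau> p X = X$3 + \<tau> * (p$2 * X$1 - p$1 * X$2)"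

definition heis_cross :: "real \<Rightarrow> real ^ 3 \<Rightarrow> real ^ 3 \<Rightarrow> real ^ 3 \<Rightarrow> real ^ 3" where
  "heis_cross \<tau> p X Y =
     (X$2 * heis_coeff3 \<tau> p Y - heis_coeff3 \<tau> p X * Y$2) *\<^sub>R heis_E1 \<tau> p
     + (X$1 * heis_coeff3 \<tau> p Y - heis_coeff3 \<tau> p X * Y$1) *\<^sub>R heis_E2 \<tau> p
     + (X$1 * Y$2 - X$2 * Y$1) *\<^sub>R heis_E3"

lemmas heis_frame_defs =
  heis_metric_def heis_E1_def heis_E2_def heis_E3_def heis_coeff3_def heis_cross_def

lemma heis_frame_orthonormal:
  "heis_metric \<tau> p (heis_E1 \<tau> p) (heis_E1 \<tau> p) = 1"
  "heis_metric \<tau> p (heis_E2 \<tau> p) (heis_E2 \<tau> p) = -1"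
  "heis_metric \<tau> p heis_E3 heis_E3 = 1"
  "heis_metric \<tau> p (heis_E1 \<tau> p) (heis_E2 \<tau> p) = 0"
  "heis_metric \<tau> p (heis_E1 \<tau> p) heis_E3 = 0"
  "heis_metric \<tau> p (heis_E2 \<tau> p) heis_E3 = 0"
  by (simp_all add: heis_frame_defs)

lemma heis_frame_expansion:
  "X = X$1 *\<^sub>R heis_E1 \<tau> p + X$2 *\<^sub>R heis_E2 \<tau> p + heis_coeff3 \<tau> p X *\<^sub>R heis_E3"
  by (simp add: heis_frame_defs vec_eq_iff forall_3 algebra_simps)

lemma heis_cross_frame:
  "heis_cross \<tau> p (heis_E1 \<tau> p) (heis_E2 \<tau> p) = heis_E3"
  "heis_cross \<tau> p (heis_E2 \<tau> p) heis_E3 = heis_E1 \<tau> p"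
  "heis_cross \<tau> p (heis_E1 \<tau> p) heis_E3 = heis_E2 \<tau> p"
  by (simp_all add: heis_frame_defs vec_eq_iff forall_3)

lemma heis_cross_skew: "heis_cross \<tau> p Y X = - heis_cross \<tau> p X Y"
  by (simp add: heis_frame_defs vec_eq_iff forall_3 algebra_simps)

lemma bilinear_heis_cross: "bilinear (heis_cross \<tau> p)"
  by (auto simp: bilinear_def linear_iff heis_frame_defs vec_eq_iff forall_3 algebra_simps)

text \<open>An immersed oriented surface is described by its position vector \<open>F\<close> in local coordinates
  ranging over \<open>U\<close>, together with its unit normal \<open>N\<close>, a vector field along \<open>F\<close>;
  injectivity of the derivative makes \<open>F\<close> an immersion.\<close>

definition oriented_surface ::
    "real \<Rightarrow> real \<Rightarrow> (real \<times> real) set \<Rightarrow> (real \<times> real \<Rightarrow> real ^ 3) \<Rightarrow> (real \<times> real \<Rightarrow> real ^ 3) \<Rightarrow> bool"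
  where
  "oriented_surface \<tau> \<epsilon> U F N \<longleftrightarrow>
     (\<epsilon> = 1 \<or> \<epsilon> = -1) \<and> open U \<and> connected U \<and> smooth_on U F \<and> smooth_on U N \<and>
     (\<forall>q\<in>U. inj (frechet_derivative F (at q)) \<and>
            heis_metric \<tau> (F q) (N q) (N q) = \<epsilon> \<and>
            (\<forall>w. heis_metric \<tau> (F q) (N q) (frechet_derivative F (at q) w) = 0))"

text \<open>In the next three definitions \<open>p\<close> is a point of the surface and \<open>n\<close> is the unit normal
  at \<open>p\<close>.\<close>

definition angle_fun :: "real \<Rightarrow> real \<Rightarrow> real ^ 3 \<Rightarrow> real ^ 3 \<Rightarrow> real" where
  "angle_fun \<tau> \<epsilon> p n = \<epsilon> * heis_metric \<tau> p n heis_E3"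

definition tangential_E3 :: "real \<Rightarrow> real \<Rightarrow> real ^ 3 \<Rightarrow> real ^ 3 \<Rightarrow> real ^ 3" where
  "tangential_E3 \<tau> \<epsilon> p n = heis_E3 - angle_fun \<tau> \<epsilon> p n *\<^sub>R n"

definition rotation_J :: "real \<Rightarrow> real ^ 3 \<Rightarrow> real ^ 3 \<Rightarrow> real ^ 3 \<Rightarrow> real ^ 3" where
  "rotation_J \<tau> p n X = heis_cross \<tau> p n X"

definition helix_surface ::
    "real \<Rightarrow> real \<Rightarrow> (real \<times> real) set \<Rightarrow> (real \<times> real \<Rightarrow> real ^ 3) \<Rightarrow> (real \<times> real \<Rightarrow> real ^ 3) \<Rightarrow> bool"
  where
  "helix_surface \<tau> \<epsilon> U F N \<longleftrightarrow>
     oriented_surface \<tau> \<epsilon> U F N \<and> (\<lambda>q. angle_fun \<tau> \<epsilon> (F q) (N q)) constant_on U"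

end

theory Submission
  imports Defs
begin

text \<open>
  The coordinate fields \<open>\<partial>\<^sub>u = T\<close> and \<open>\<partial>\<^sub>v = a T + b JT\<close>, written in the frame
  \<open>E\<^sub>1, E\<^sub>2, E\<^sub>3\<close>, give a first order system for the components \<open>x, y, z\<close> of the position vector
  (\<open>helix_tangent_frame\<close>).  With \<open>S = sinh \<theta>\<close>, \<open>C = cosh \<theta>\<close>, \<open>k = 2 \<tau> S\<^sup>2\<close> and \<open>X = k u + \<eta> + \<phi>\<close> its
  first two rows are

  \<open>x\<^sub>u = - S C sinh \<phi>\<close>, \<open>x\<^sub>v = C cosh X\<close>, \<open>y\<^sub>u = - S C cosh \<phi>\<close>, \<open>y\<^sub>v = C sinh X\<close>.

  The mixed partial derivatives of \<open>x\<close> and \<open>y\<close> agree (\<open>mixed_partials_agree\<close>), and this alone forces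
  \<open>\<phi> = - k u + c\<close> (\<open>rotation_angle_affine\<close>).  Hence \<open>X = \<eta> + c\<close> is a function of \<open>v\<close>.

  The explicit terms in \<open>u\<close> in the three components of the claimed formula are primitives of the \<open>u\<close>-derivatives.
  Subtracting them leaves functions with differentials \<open>C cosh (\<eta> + c) dv\<close>, \<open>C sinh (\<eta> + c) dv\<close> and
  \<open>\<tau> (f\<^sub>1 f\<^sub>2' - f\<^sub>2 f\<^sub>1') dv\<close>.  By \<open>function_of_second_coordinate\<close> these are smooth functions
  \<open>f\<^sub>1, f\<^sub>2, f\<^sub>3\<close> of \<open>v\<close>, and the two differential equations are the identity \<open>cosh\<^sup>2 - sinh\<^sup>2 = 1\<close> and the third
  differential itself.
\<close>

section \<open>Calculus of smooth functions\<close>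

lemma times_differentiable_on_cong:
  assumes "open S" "\<And>x. x \<in> S \<Longrightarrow> f x = g x" "times_differentiable_on k S f"
  shows "times_differentiable_on k S g"
  using assms(2,3)
proof (induction k arbitrary: f g)
  case 0
  then show ?case by (simp add: continuous_on_eq)
next
  case (Suc k)
  have d: "f differentiable (at x)" if "x \<in> S" for x
    using Suc.prems that by simp
  have "g differentiable (at x)" if "x \<in> S" for x
    using has_derivative_transform_within_open[OF _ assms(1) that] d[OF that] Suc.prems(1)
    unfolding differentiable_def by blast
  moreover have "times_differentiable_on k S (\<lambda>x. frechet_derivative g (at x) w)" for w
  proof (rule Suc.IH)
    show "times_differentiable_on k S (\<lambda>x. frechet_derivative f (at x) w)"
      using Suc.prems by simp
    show "frechet_derivative f (at x) w = frechet_derivative g (at x) w" if "x \<in> S" for x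
      using frechet_derivative_transform_within_open[OF d[OF that] assms(1) that] Suc.prems by metis
  qed
  ultimately show ?case by simp
qed

text \<open>Any derivative \<open>f'\<close> found by calculation may stand for the Frechet derivative, because the two agree
on the open set \<open>S\<close>; this is how the closure properties below are proved.\<close>

lemma times_differentiable_on_SucI:
  assumes "open S" "\<And>x. x \<in> S \<Longrightarrow> (f has_derivative f' x) (at x)"
    and "\<And>w. times_differentiable_on k S (\<lambda>x. f' x w)"
  shows "times_differentiable_on (Suc k) S f"
proof -
  have "times_differentiable_on k S (\<lambda>x. frechet_derivative f (at x) w)" for w
    by (rule times_differentiable_on_cong[OF assms(1) _ assms(3)[of w]])
      (metis assms(2) frechet_derivative_at)
  then show ?thesis using assms(2) by (auto simp: differentiable_def)
qed

lemma times_differentiable_on_SucD: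
  "times_differentiable_on (Suc k) S f \<Longrightarrow> times_differentiable_on k S f"
proof (induction k arbitrary: f)
  case 0
  then show ?case
    by (auto intro!: continuous_at_imp_continuous_on differentiable_imp_continuous_within)
next
  case (Suc k)
  have "f differentiable (at x)" if "x \<in> S" for x
    using Suc.prems that by (subst (asm) times_differentiable_on.simps) blast
  moreover have "times_differentiable_on k S (\<lambda>x. frechet_derivative f (at x) w)" for w
    using Suc.prems by (intro Suc.IH) (subst (asm) (1) times_differentiable_on.simps, blast)
  ultimately show ?case by simp
qed

lemma times_differentiable_on_has_derivative:
  assumes "times_differentiable_on (Suc k) S f" "x \<in> S"
  shows "(f has_derivative frechet_derivative f (at x)) (at x)"
  using assms by (simp add: frechet_derivative_works)

lemma times_differentiable_on_const: "times_differentiable_on k S (\<lambda>_. c)"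
proof (induction k arbitrary: c)
  case (Suc k)
  then show ?case by (simp add: frechet_derivative_const)
qed simp

lemma times_differentiable_on_add:
  assumes "open S"
  shows "times_differentiable_on k S f \<Longrightarrow> times_differentiable_on k S g \<Longrightarrow>
    times_differentiable_on k S (\<lambda>x. f x + g x)"
proof (induction k arbitrary: f g)
  case 0
  then show ?case by (simp add: continuous_on_add)
next
  case (Suc k)
  show ?case
  proof (rule times_differentiable_on_SucI[OF assms])
    fix x assume "x \<in> S"
    then show "((\<lambda>x. f x + g x) has_derivative (\<lambda>w. frechet_derivative f (at x) w
       + frechet_derivative g (at x) w)) (at x)"
      by (intro has_derivative_add times_differentiable_on_has_derivative[OF Suc.prems(1)]
          times_differentiable_on_has_derivative[OF Suc.prems(2)])
  qed (use Suc in simp)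
qed

lemma times_differentiable_on_mult:
  fixes f g :: "'a::euclidean_space \<Rightarrow> real"
  assumes "open S"
  shows "times_differentiable_on k S f \<Longrightarrow> times_differentiable_on k S g \<Longrightarrow>
    times_differentiable_on k S (\<lambda>x. f x * g x)"
proof (induction k arbitrary: f g)
  case 0
  then show ?case by (simp add: continuous_on_mult)
next
  case (Suc k)
  show ?case
  proof (rule times_differentiable_on_SucI[OF assms])
    fix x assume "x \<in> S"
    then show "((\<lambda>x. f x * g x) has_derivative (\<lambda>w. f x * frechet_derivative g (at x) w
       + frechet_derivative f (at x) w * g x)) (at x)"
      by (intro has_derivative_mult times_differentiable_on_has_derivative[OF Suc.prems(1)]
          times_differentiable_on_has_derivative[OF Suc.prems(2)])
  next
    fix w
    show "times_differentiable_on k S (\<lambda>x. f x * frechet_derivative g (at x) w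
       + frechet_derivative f (at x) w * g x)"
      using Suc.prems times_differentiable_on_SucD[OF Suc.prems(1)]
        times_differentiable_on_SucD[OF Suc.prems(2)]
      by (intro times_differentiable_on_add[OF assms] Suc.IH) simp_all
  qed
qed

text \<open>Neither function can be treated alone: the derivative of each composite contains the other one,
so the induction on the order of differentiability has to carry both.\<close>

lemma times_differentiable_on_cosh_sinh:
  fixes f :: "'a::euclidean_space \<Rightarrow> real"
  assumes "open S" "times_differentiable_on k S f"
  shows "times_differentiable_on k S (\<lambda>x. cosh (f x)) \<and> times_differentiable_on k S (\<lambda>x. sinh (f x))"
  using assms(2)
proof (induction k)
  case 0
  then show ?case by (auto intro!: continuous_intros)
next
  case (Suc k)
  note IH = Suc.IH[OF times_differentiable_on_SucD[OF Suc.prems]]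
  note D = times_differentiable_on_has_derivative[OF Suc.prems]
  have D': "times_differentiable_on k S (\<lambda>x. frechet_derivative f (at x) w)" for w
    using Suc.prems by simp
  have "times_differentiable_on (Suc k) S (\<lambda>x. cosh (f x))"
  proof (rule times_differentiable_on_SucI[OF assms(1)])
    show "((\<lambda>x. cosh (f x)) has_derivative (\<lambda>w. sinh (f x) * frechet_derivative f (at x) w)) (at x)"
      if "x \<in> S" for x
      using DERIV_compose_FDERIV[OF has_field_derivative_cosh[OF DERIV_ident] D[OF that]] by (simp add: mult.commute)
  qed (intro times_differentiable_on_mult assms(1) D' conjunct2[OF IH])
  moreover have "times_differentiable_on (Suc k) S (\<lambda>x. sinh (f x))"
  proof (rule times_differentiable_on_SucI[OF assms(1)])
    show "((\<lambda>x. sinh (f x)) has_derivative (\<lambda>w. cosh (f x) * frechet_derivative f (at x) w)) (at x)"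
      if "x \<in> S" for x
      using DERIV_compose_FDERIV[OF has_field_derivative_sinh[OF DERIV_ident] D[OF that]] by (simp add: mult.commute)
  qed (intro times_differentiable_on_mult assms(1) D' conjunct1[OF IH])
  ultimately show ?case ..
qed

lemma smooth_on_const: "smooth_on S (\<lambda>_. c)"
  by (simp add: smooth_on_def times_differentiable_on_const)

lemma smooth_on_add:
  "open S \<Longrightarrow> smooth_on S f \<Longrightarrow> smooth_on S g \<Longrightarrow> smooth_on S (\<lambda>x. f x + g x)"
  by (simp add: smooth_on_def times_differentiable_on_add)

lemma smooth_on_mult:
  fixes f g :: "'a::euclidean_space \<Rightarrow> real"
  shows "open S \<Longrightarrow> smooth_on S f \<Longrightarrow> smooth_on S g \<Longrightarrow> smooth_on S (\<lambda>x. f x * g x)"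
  by (simp add: smooth_on_def times_differentiable_on_mult)

lemma smooth_on_cosh:
  fixes f :: "'a::euclidean_space \<Rightarrow> real"
  shows "open S \<Longrightarrow> smooth_on S f \<Longrightarrow> smooth_on S (\<lambda>x. cosh (f x))"
  by (simp add: smooth_on_def times_differentiable_on_cosh_sinh)

lemma smooth_on_sinh:
  fixes f :: "'a::euclidean_space \<Rightarrow> real"
  shows "open S \<Longrightarrow> smooth_on S f \<Longrightarrow> smooth_on S (\<lambda>x. sinh (f x))"
  by (simp add: smooth_on_def times_differentiable_on_cosh_sinh)

lemma smooth_on_has_derivative:
  assumes "smooth_on S f" "x \<in> S"
  shows "(f has_derivative frechet_derivative f (at x)) (at x)"
  using assms times_differentiable_on_has_derivative unfolding smooth_on_def by blast

lemma smooth_on_imp_continuous_on: "smooth_on S f \<Longrightarrow> continuous_on S f"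
  unfolding smooth_on_def by (metis times_differentiable_on.simps(1))

lemma smooth_on_frechet_derivative:
  "smooth_on S f \<Longrightarrow> smooth_on S (\<lambda>x. frechet_derivative f (at x) w)"
  unfolding smooth_on_def by (metis times_differentiable_on.simps(2))

lemma smooth_on_antiderivative:
  fixes f g :: "real \<Rightarrow> real"
  assumes "open S" "\<And>x. x \<in> S \<Longrightarrow> (f has_real_derivative g x) (at x)" "smooth_on S g"
  shows "smooth_on S f"
  unfolding smooth_on_def
proof
  fix k
  have "times_differentiable_on (Suc k) S f"
  proof (rule times_differentiable_on_SucI[OF assms(1)])
    show "(f has_derivative (\<lambda>w. g x * w)) (at x)" if "x \<in> S" for x
      using assms(2)[OF that] by (simp add: has_field_derivative_def)
    show "times_differentiable_on k S (\<lambda>x. g x * w)" for w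
      using assms(1,3) by (auto simp: smooth_on_def intro: times_differentiable_on_mult times_differentiable_on_const)
  qed
  then show "times_differentiable_on k S f" by (rule times_differentiable_on_SucD)
qed

section \<open>Functions determined by their differentials\<close>

text \<open>An open connected set of reals is the interval between its infimum and supremum in the extended
reals, and on such an interval every continuous function has an antiderivative.\<close>

lemma antiderivative_open_connected:
  fixes g :: "real \<Rightarrow> real"
  assumes "open I" "connected I" "continuous_on I g"
  shows "\<exists>f. \<forall>x\<in>I. (f has_real_derivative g x) (at x)"
proof (cases "I = {}")
  case False
  define l u where "l = Inf (ereal ` I)" and "u = Sup (ereal ` I)"
  have in_I: "x \<in> I" if "l < ereal x" "ereal x < u" for x
  proof -
    obtain y z where "y \<in> I" "y < x" "z \<in> I" "x < z"
      using \<open>l < ereal x\<close> \<open>ereal x < u\<close> unfolding l_def u_def by (auto simp: Inf_less_iff less_Sup_iff)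
    then show ?thesis using connected_contains_Icc[OF assms(2), of y z] by auto
  qed
  have between: "l < ereal x \<and> ereal x < u" if x: "x \<in> I" for x
  proof -
    obtain e where "e > 0" "ball x e \<subseteq> I"
      by (rule openE[OF assms(1) x])
    have "x - e/2 \<in> ball x e" "x + e/2 \<in> ball x e"
      using \<open>e > 0\<close> by (simp_all add: dist_real_def)
    then have "x - e/2 \<in> I" "x + e/2 \<in> I"
      using subsetD[OF \<open>ball x e \<subseteq> I\<close>] by simp_all
    then have "l \<le> ereal (x - e/2)" "ereal (x + e/2) \<le> u"
      unfolding l_def u_def by (auto intro: Inf_lower Sup_upper)
    moreover have "ereal (x - e/2) < x" "ereal x < x + e/2" using \<open>e > 0\<close> by auto
    ultimately show ?thesis by (simp add: le_less_trans[of l "ereal (x - e/2)"] less_le_trans[of _ "ereal (x + e/2)" u])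
  qed
  obtain x0 where "x0 \<in> I" using False by blast
  then have "l < u" using less_trans[of l "ereal x0" u] between[of x0] by simp
  moreover have "isCont g x" if "l < ereal x" "ereal x < u" for x
    using in_I[OF that] assms(1,3) continuous_on_eq_continuous_at by blast
  ultimately obtain f where "\<forall>x. l < ereal x \<longrightarrow> ereal x < u \<longrightarrow> (f has_vector_derivative g x) (at x)"
    using einterval_antiderivative by blast
  then show ?thesis
    using between by (metis has_real_derivative_iff_has_vector_derivative)
qed simp

lemma has_derivative_zero_constant_on_open:
  fixes h :: "'a::real_normed_vector \<Rightarrow> 'b::real_normed_vector"
  assumes "open U" "connected U" "\<And>z. z \<in> U \<Longrightarrow> (h has_derivative (\<lambda>w. 0)) (at z)"
  shows "h constant_on U"
proof (cases "U = {}")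
  case False
  then obtain z0 where "z0 \<in> U" by auto
  then have "h z = h z0" if "z \<in> U" for z
    using has_derivative_zero_unique_connected[OF assms that] by simp
  then show ?thesis unfolding constant_on_def by simp
qed (simp add: constant_on_def)

text \<open>A function whose differential is \<open>g(v) dv\<close> depends on \<open>v\<close> alone, and it does so on the whole of
\<open>U\<close> even if some of the slices \<open>v = const\<close> of \<open>U\<close> are disconnected: the set of values of \<open>v\<close> is an
open interval, so \<open>g\<close> has a primitive there, and the difference between the function and this primitive
is constant on the connected set \<open>U\<close>.\<close>

lemma function_of_second_coordinate:
  fixes h :: "real \<times> real \<Rightarrow> real"
  assumes "open U" "connected U" "smooth_on (snd ` U) g"
    and h: "\<And>z. z \<in> U \<Longrightarrow> (h has_derivative (\<lambda>w. g (snd z) * snd w)) (at z)"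
  obtains f where "smooth_on (snd ` U) f" "\<And>v. v \<in> snd ` U \<Longrightarrow> (f has_real_derivative g v) (at v)"
    "\<And>u v. (u, v) \<in> U \<Longrightarrow> h (u, v) = f v"
proof -
  have I: "open (snd ` U)" "connected (snd ` U)"
    using assms(1,2) open_image_snd connected_continuous_image[OF continuous_on_snd[OF continuous_on_id]]
    by auto
  obtain f0 where f0: "\<And>v. v \<in> snd ` U \<Longrightarrow> (f0 has_real_derivative g v) (at v)"
    using antiderivative_open_connected[OF I smooth_on_imp_continuous_on[OF assms(3)]] by blast
  have "((\<lambda>z. h z - f0 (snd z)) has_derivative (\<lambda>w. 0)) (at z)" if "z \<in> U" for z
  proof -
    have "(f0 has_derivative (\<lambda>w. g (snd z) * w)) (at (snd z))"
      using f0 that by (simp add: has_field_derivative_def)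
    from has_derivative_compose[OF has_derivative_snd[OF has_derivative_ident] this]
    have "((\<lambda>z. f0 (snd z)) has_derivative (\<lambda>w. g (snd z) * snd w)) (at z)" .
    from has_derivative_diff[OF h[OF that] this] show ?thesis by simp
  qed
  from has_derivative_zero_constant_on_open[OF assms(1,2) this]
  obtain k where k: "\<And>z. z \<in> U \<Longrightarrow> h z - f0 (snd z) = k"
    unfolding constant_on_def by auto
  show thesis
  proof
    show d: "((\<lambda>v. f0 v + k) has_real_derivative g v) (at v)" if "v \<in> snd ` U" for v
      using f0[OF that] by (auto intro!: derivative_eq_intros)
    show "smooth_on (snd ` U) (\<lambda>v. f0 v + k)"
      by (rule smooth_on_antiderivative[OF I(1) d assms(3)])
    show "h (u, v) = f0 v + k" if "(u, v) \<in> U" for u v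
      using k[OF that] by simp
  qed
qed

section \<open>Symmetry of mixed partial derivatives\<close>

text \<open>The second difference of \<open>f\<close> over a square of side \<open>h\<close> at \<open>q\<close> equals, by the mean value theorem applied twice
in either order, \<open>h\<^sup>2\<close> times a value of \<open>P'\<close> and \<open>h\<^sup>2\<close> times a value of \<open>Q'\<close> in this square;
continuity at \<open>q\<close> forces the two limits to agree.\<close>

lemma mixed_partials_agree:
  fixes f P Q P' Q' :: "real \<times> real \<Rightarrow> real"
  assumes "open U" "q \<in> U"
    and P: "\<And>x y. (x, y) \<in> U \<Longrightarrow> ((\<lambda>s. f (s, y)) has_real_derivative P (x, y)) (at x)"
    and Q: "\<And>x y. (x, y) \<in> U \<Longrightarrow> ((\<lambda>t. f (x, t)) has_real_derivative Q (x, y)) (at y)"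
    and P': "\<And>x y. (x, y) \<in> U \<Longrightarrow> ((\<lambda>t. P (x, t)) has_real_derivative P' (x, y)) (at y)"
    and Q': "\<And>x y. (x, y) \<in> U \<Longrightarrow> ((\<lambda>s. Q (s, y)) has_real_derivative Q' (x, y)) (at x)"
    and "continuous_on U P'" "continuous_on U Q'"
  shows "P' q = Q' q"
proof (rule ccontr)
  assume ne: "P' q \<noteq> Q' q"
  define e where "e = \<bar>P' q - Q' q\<bar> / 2"
  have "e > 0" using ne by (simp add: e_def)
  have "isCont P' q" "isCont Q' q"
    using assms continuous_on_eq_continuous_at by blast+
  then obtain d1 d2 where d12: "d1 > 0" "d2 > 0"
      "\<And>z. dist z q < d1 \<Longrightarrow> dist (P' z) (P' q) < e"
      "\<And>z. dist z q < d2 \<Longrightarrow> dist (Q' z) (Q' q) < e"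
    using \<open>e > 0\<close> unfolding continuous_at_eps_delta by metis
  obtain d3 where d3: "d3 > 0" "ball q d3 \<subseteq> U" using assms(1,2) openE by blast
  \<comment> \<open>a point of the square of side \<open>h\<close> is at distance at most \<open>2 h\<close> from \<open>q\<close>,
    and this has to be less than each of the radii\<close>
  define h where "h = Min {d1, d2, d3} / 3"
  have h: "h > 0" "2 * h < d1" "2 * h < d2" "2 * h < d3"
    using d12 d3 by (auto simp: h_def min_def)
  obtain a b where q: "q = (a, b)" by (cases q)
  have near: "dist (x, y) q \<le> 2 * h" if "a \<le> x" "x \<le> a + h" "b \<le> y" "y \<le> b + h" for x y
  proof -
    have "dist (x, y) q \<le> dist x a + dist y b"
      unfolding q dist_prod_def by (simp add: sqrt_sum_squares_le_sum)
    then show ?thesis using that by (simp add: dist_real_def)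
  qed
  then have box: "(x, y) \<in> U" if "a \<le> x" "x \<le> a + h" "b \<le> y" "y \<le> b + h" for x y
    using that h(4) d3(2) by (force simp: subset_iff dist_commute)
  let ?D = "f (a + h, b + h) - f (a + h, b) - f (a, b + h) + f (a, b)"
  have "\<exists>z. z > a \<and> z < a + h \<and> (f (a + h, b + h) - f (a + h, b)) - (f (a, b + h) - f (a, b))
      = (a + h - a) * (P (z, b + h) - P (z, b))"
    using h(1) by (intro MVT2 DERIV_diff P box) auto
  then obtain x1 where x1: "a < x1" "x1 < a + h" "?D = h * (P (x1, b + h) - P (x1, b))"
    by (auto simp: algebra_simps)
  have "\<exists>z. z > b \<and> z < b + h \<and> P (x1, b + h) - P (x1, b) = (b + h - b) * P' (x1, z)"
    using h(1) x1 by (intro MVT2 P' box) auto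
  then obtain y1 where y1: "b < y1" "y1 < b + h" "P (x1, b + h) - P (x1, b) = h * P' (x1, y1)"
    by auto
  have "\<exists>z. z > b \<and> z < b + h \<and> (f (a + h, b + h) - f (a, b + h)) - (f (a + h, b) - f (a, b))
      = (b + h - b) * (Q (a + h, z) - Q (a, z))"
    using h(1) by (intro MVT2 DERIV_diff Q box) auto
  then obtain y2 where y2: "b < y2" "y2 < b + h" "?D = h * (Q (a + h, y2) - Q (a, y2))"
    by (auto simp: algebra_simps)
  have "\<exists>z. z > a \<and> z < a + h \<and> Q (a + h, y2) - Q (a, y2) = (a + h - a) * Q' (z, y2)"
    using h(1) y2 by (intro MVT2 Q' box) auto
  then obtain x2 where x2: "a < x2" "x2 < a + h" "Q (a + h, y2) - Q (a, y2) = h * Q' (x2, y2)"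
    by auto
  have "P' (x1, y1) = Q' (x2, y2)"
    using x1(3) y1(3) y2(3) x2(3) h(1) by simp
  moreover have "dist (P' (x1, y1)) (P' q) < e"
    using near[of x1 y1] x1 y1 h by (intro d12(3)) auto
  moreover have "dist (Q' (x2, y2)) (Q' q) < e"
    using near[of x2 y2] x2 y2 h by (intro d12(4)) auto
  ultimately show False
    by (simp add: e_def dist_real_def abs_if split: if_splits)
qed


lemma has_derivative_imp_partials:
  fixes f :: "real \<times> real \<Rightarrow> real"
  assumes "(f has_derivative f') (at (x, y))"
  shows "((\<lambda>s. f (s, y)) has_real_derivative f' (1, 0)) (at x)"
    and "((\<lambda>t. f (x, t)) has_real_derivative f' (0, 1)) (at y)"
proof -
  interpret f': bounded_linear f' using assms by (rule has_derivative_bounded_linear)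
  have "((\<lambda>s. f (s, y)) has_derivative (\<lambda>h. f' (h, 0))) (at x)"
    by (rule has_derivative_compose[of "\<lambda>s. (s, y)" "\<lambda>h. (h, 0)", OF _ assms])
      (intro has_derivative_Pair has_derivative_ident has_derivative_const)
  moreover have "(\<lambda>h. f' (h, 0)) = (*) (f' (1, 0))"
  proof
    show "f' (h, 0) = f' (1, 0) * h" for h
      using f'.scaleR[of h "(1, 0)"] by simp
  qed
  ultimately show "((\<lambda>s. f (s, y)) has_real_derivative f' (1, 0)) (at x)"
    by (simp only: has_field_derivative_def)
  have "((\<lambda>t. f (x, t)) has_derivative (\<lambda>h. f' (0, h))) (at y)"
    by (rule has_derivative_compose[of "\<lambda>t. (x, t)" "\<lambda>h. (0, h)", OF _ assms])
      (intro has_derivative_Pair has_derivative_ident has_derivative_const)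
  moreover have "(\<lambda>h. f' (0, h)) = (*) (f' (0, 1))"
  proof
    show "f' (0, h) = f' (0, 1) * h" for h
      using f'.scaleR[of h "(0, 1)"] by simp
  qed
  ultimately show "((\<lambda>t. f (x, t)) has_real_derivative f' (0, 1)) (at y)"
    by (simp only: has_field_derivative_def)
qed

section \<open>The rotation angle of the normal\<close>

text \<open>The compatibility condition of the system.  Put \<open>X = k u + \<eta> + \<phi>\<close>.  Equality of the mixed
partial derivatives of \<open>x\<close> and of \<open>y\<close> reads
\<open>A cosh \<phi> \<phi>\<^sub>v = C sinh X (k + \<phi>\<^sub>u)\<close> and \<open>A sinh \<phi> \<phi>\<^sub>v = C cosh X (k + \<phi>\<^sub>u)\<close>.
This is a homogeneous linear system for \<open>\<phi>\<^sub>v\<close> and \<open>k + \<phi>\<^sub>u\<close> whose determinant is \<open>A C cosh (X - \<phi>)\<close> up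
to sign, and the hyperbolic cosine has no zero; so \<open>\<phi>\<^sub>v = 0\<close> and \<open>\<phi>\<^sub>u = - k\<close>.\<close>

lemma rotation_angle_affine:
  fixes x y \<phi> :: "real \<times> real \<Rightarrow> real" and \<eta> :: "real \<Rightarrow> real" and A C k :: real
  assumes U: "open U" "connected U" and \<phi>: "smooth_on U \<phi>" and \<eta>: "smooth_on (snd ` U) \<eta>"
    and "A \<noteq> 0" "C \<noteq> 0"
    and x: "\<And>u v. (u, v) \<in> U \<Longrightarrow> (x has_derivative
      (\<lambda>w. A * sinh (\<phi> (u, v)) * fst w + C * cosh (k * u + \<eta> v + \<phi> (u, v)) * snd w)) (at (u, v))"
    and y: "\<And>u v. (u, v) \<in> U \<Longrightarrow> (y has_derivative
      (\<lambda>w. A * cosh (\<phi> (u, v)) * fst w + C * sinh (k * u + \<eta> v + \<phi> (u, v)) * snd w)) (at (u, v))"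
  shows "\<exists>c. \<forall>(u, v)\<in>U. \<phi> (u, v) = - k * u + c"
proof -
  define \<phi>u where "\<phi>u = (\<lambda>z. frechet_derivative \<phi> (at z) (1, 0))"
  define \<phi>v where "\<phi>v = (\<lambda>z. frechet_derivative \<phi> (at z) (0, 1))"
  define X where "X = (\<lambda>z. k * fst z + \<eta> (snd z) + \<phi> z)"
  note D\<phi> = smooth_on_has_derivative[OF \<phi>]
  have \<phi>_u: "((\<lambda>s. \<phi> (s, v)) has_real_derivative \<phi>u (u, v)) (at u)"
    and \<phi>_v: "((\<lambda>t. \<phi> (u, t)) has_real_derivative \<phi>v (u, v)) (at v)" if "(u, v) \<in> U" for u v
    using has_derivative_imp_partials[OF D\<phi>[OF that]] by (simp_all add: \<phi>u_def \<phi>v_def)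
  have cont: "continuous_on U \<phi>" "continuous_on U \<phi>u" "continuous_on U \<phi>v"
    unfolding \<phi>u_def \<phi>v_def
    by (intro smooth_on_imp_continuous_on smooth_on_frechet_derivative \<phi>)+
  have "continuous_on U (\<lambda>z. \<eta> (snd z))"
    by (rule continuous_on_compose2[OF smooth_on_imp_continuous_on[OF \<eta>] continuous_on_snd[OF continuous_on_id]])
      auto
  then have contX: "continuous_on U X"
    unfolding X_def by (intro continuous_intros cont)
  have eq1: "A * cosh (\<phi> q) * \<phi>v q = C * sinh (X q) * (k + \<phi>u q)" if "q \<in> U" for q
  proof (rule mixed_partials_agree[where f = x and P = "\<lambda>z. A * sinh (\<phi> z)"
        and Q = "\<lambda>z. C * cosh (X z)", OF U(1) that])
    show "continuous_on U (\<lambda>q. A * cosh (\<phi> q) * \<phi>v q)"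
      "continuous_on U (\<lambda>q. C * sinh (X q) * (k + \<phi>u q))"
      by (intro continuous_intros cont contX)+
    fix u v assume uv: "(u, v) \<in> U"
    show "((\<lambda>s. x (s, v)) has_real_derivative A * sinh (\<phi> (u, v))) (at u)"
      "((\<lambda>t. x (u, t)) has_real_derivative C * cosh (X (u, v))) (at v)"
      using has_derivative_imp_partials[OF x[OF uv]] by (simp_all add: X_def)
    show "((\<lambda>t. A * sinh (\<phi> (u, t))) has_real_derivative A * cosh (\<phi> (u, v)) * \<phi>v (u, v)) (at v)"
      using \<phi>_v[OF uv] by (auto intro!: derivative_eq_intros)
    show "((\<lambda>s. C * cosh (X (s, v))) has_real_derivative C * sinh (X (u, v)) * (k + \<phi>u (u, v))) (at u)"
      using \<phi>_u[OF uv] by (auto simp: X_def intro!: derivative_eq_intros)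
  qed
  have eq2: "A * sinh (\<phi> q) * \<phi>v q = C * cosh (X q) * (k + \<phi>u q)" if "q \<in> U" for q
  proof (rule mixed_partials_agree[where f = y and P = "\<lambda>z. A * cosh (\<phi> z)"
        and Q = "\<lambda>z. C * sinh (X z)", OF U(1) that])
    show "continuous_on U (\<lambda>q. A * sinh (\<phi> q) * \<phi>v q)"
      "continuous_on U (\<lambda>q. C * cosh (X q) * (k + \<phi>u q))"
      by (intro continuous_intros cont contX)+
    fix u v assume uv: "(u, v) \<in> U"
    show "((\<lambda>s. y (s, v)) has_real_derivative A * cosh (\<phi> (u, v))) (at u)"
      "((\<lambda>t. y (u, t)) has_real_derivative C * sinh (X (u, v))) (at v)"
      using has_derivative_imp_partials[OF y[OF uv]] by (simp_all add: X_def)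
    show "((\<lambda>t. A * cosh (\<phi> (u, t))) has_real_derivative A * sinh (\<phi> (u, v)) * \<phi>v (u, v)) (at v)"
      using \<phi>_v[OF uv] by (auto intro!: derivative_eq_intros)
    show "((\<lambda>s. C * sinh (X (s, v))) has_real_derivative C * cosh (X (u, v)) * (k + \<phi>u (u, v))) (at u)"
      using \<phi>_u[OF uv] by (auto simp: X_def intro!: derivative_eq_intros)
  qed
  have partials: "\<phi>v q = 0 \<and> \<phi>u q = - k" if "q \<in> U" for q
  proof -
    have "A * \<phi>v q * cosh (X q - \<phi> q)
        = A * cosh (\<phi> q) * \<phi>v q * cosh (X q) - A * sinh (\<phi> q) * \<phi>v q * sinh (X q)"
      by (simp add: cosh_diff algebra_simps)
    also have "\<dots> = 0"
      unfolding eq1[OF that] eq2[OF that] by (simp add: algebra_simps)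
    finally have "\<phi>v q = 0"
      using \<open>A \<noteq> 0\<close> cosh_real_pos[of "X q - \<phi> q"] by simp
    then show ?thesis
      using eq2[OF that] \<open>C \<noteq> 0\<close> cosh_real_pos[of "X q"] by simp
  qed
  have "((\<lambda>z. \<phi> z + k * fst z) has_derivative (\<lambda>w. 0)) (at z)" if "z \<in> U" for z
  proof -
    interpret bounded_linear "frechet_derivative \<phi> (at z)"
      using D\<phi>[OF that] by (rule has_derivative_bounded_linear)
    have "frechet_derivative \<phi> (at z) w = - k * fst w" for w
    proof -
      have "w = fst w *\<^sub>R (1, 0) + snd w *\<^sub>R (0, 1)" by (simp add: prod_eq_iff)
      then have "frechet_derivative \<phi> (at z) w = fst w * \<phi>u z + snd w * \<phi>v z"
        unfolding \<phi>u_def \<phi>v_def by (metis add scaleR real_scaleR_def)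
      then show ?thesis using partials[OF that] by simp
    qed
    then show ?thesis
      using D\<phi>[OF that] by (auto intro!: derivative_eq_intros)
  qed
  from has_derivative_zero_constant_on_open[OF U this]
  obtain c where "\<forall>z\<in>U. \<phi> z + k * fst z = c" unfolding constant_on_def by blast
  then have "\<forall>(u, v)\<in>U. \<phi> (u, v) = - k * u + c" by fastforce
  then show ?thesis ..
qed

section \<open>The tangent frame and the position vector\<close>

text \<open>The horizontal part of the normal \<open>n\<close> is \<open>cosh \<theta>\<close> times a unit timelike vector in the plane
spanned by \<open>E\<^sub>1\<close> and \<open>E\<^sub>2\<close>.  The tangential part of \<open>E\<^sub>3\<close> has the direction of this vector as its
horizontal direction, whereas its image under \<open>J\<close> is horizontal and orthogonal to it.\<close>

lemma helix_tangent_frame: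
  fixes \<tau> \<theta> \<phi> :: real and p :: "real ^ 3"
  defines "n \<equiv> cosh \<theta> *\<^sub>R (sinh \<phi> *\<^sub>R heis_E1 \<tau> p + cosh \<phi> *\<^sub>R heis_E2 \<tau> p) - sinh \<theta> *\<^sub>R heis_E3"
  shows "tangential_E3 \<tau> (-1) p n = (cosh \<theta>)\<^sup>2 *\<^sub>R heis_E3
      - (sinh \<theta> * cosh \<theta>) *\<^sub>R (sinh \<phi> *\<^sub>R heis_E1 \<tau> p + cosh \<phi> *\<^sub>R heis_E2 \<tau> p)" (is ?T)
    and "rotation_J \<tau> p n (tangential_E3 \<tau> (-1) p n)
      = cosh \<theta> *\<^sub>R (cosh \<phi> *\<^sub>R heis_E1 \<tau> p + sinh \<phi> *\<^sub>R heis_E2 \<tau> p)" (is ?J)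
proof -
  \<comment> \<open>\<open>n\<close> has third frame coefficient \<open>- sinh \<theta>\<close>, which the factor
    \<open>\<epsilon> = -1\<close> turns into \<open>sinh \<theta>\<close>\<close>
  have "angle_fun \<tau> (-1) p n = sinh \<theta>"
    by (simp add: angle_fun_def n_def heis_frame_defs algebra_simps)
  then show T: ?T
    unfolding tangential_E3_def n_def cosh_square_eq
    by (simp add: algebra_simps power2_eq_square)
  have "heis_coeff3 \<tau> p n = - sinh \<theta>"
    by (simp add: n_def heis_frame_defs algebra_simps)
  moreover have "heis_coeff3 \<tau> p (tangential_E3 \<tau> (-1) p n) = (cosh \<theta>)\<^sup>2"
    unfolding T by (simp add: heis_frame_defs algebra_simps)
  moreover have "n $ 1 = cosh \<theta> * sinh \<phi>" "n $ 2 = cosh \<theta> * cosh \<phi>"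
    by (simp_all add: n_def heis_frame_defs)
  moreover have "tangential_E3 \<tau> (-1) p n $ 1 = - (sinh \<theta> * cosh \<theta> * sinh \<phi>)"
      "tangential_E3 \<tau> (-1) p n $ 2 = - (sinh \<theta> * cosh \<theta> * cosh \<phi>)"
    unfolding T by (simp_all add: heis_frame_defs)
  ultimately have "rotation_J \<tau> p n (tangential_E3 \<tau> (-1) p n)
    = (cosh \<theta> * cosh \<phi> * ((cosh \<theta>)\<^sup>2 - (sinh \<theta>)\<^sup>2)) *\<^sub>R heis_E1 \<tau> p
      + (cosh \<theta> * sinh \<phi> * ((cosh \<theta>)\<^sup>2 - (sinh \<theta>)\<^sup>2)) *\<^sub>R heis_E2 \<tau> p"
    by (simp add: rotation_J_def heis_cross_def algebra_simps power2_eq_square)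
  then show ?J
    by (simp add: hyperbolic_pythagoras scaleR_right_distrib)
qed

theorem theorem5p2:
  fixes \<tau> \<theta> :: real
    and U :: "(real \<times> real) set"
    and F N T :: "real \<times> real \<Rightarrow> real ^ 3"
    and \<phi> :: "real \<times> real \<Rightarrow> real"
    and \<eta> :: "real \<Rightarrow> real"
    and a b :: "real \<Rightarrow> real \<Rightarrow> real"
  assumes tau: "\<tau> \<noteq> 0"
    and helix: "helix_surface \<tau> (-1) U F N"
    and theta: "\<theta> > 0"
    and angle: "\<And>q. q \<in> U \<Longrightarrow> angle_fun \<tau> (-1) (F q) (N q) = sinh \<theta>"
    and phi: "smooth_on U \<phi>"
    and normal: "\<And>q. q \<in> U \<Longrightarrow>
           N q = cosh \<theta> *\<^sub>R (sinh (\<phi> q) *\<^sub>R heis_E1 \<tau> (F q) + cosh (\<phi> q) *\<^sub>R heis_E2 \<tau> (F q))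
                 - sinh \<theta> *\<^sub>R heis_E3"
    and T: "\<And>q. q \<in> U \<Longrightarrow> T q = tangential_E3 \<tau> (-1) (F q) (N q)"
    and eta: "smooth_on (snd ` U) \<eta>"
    and a: "\<And>u v. (u, v) \<in> U \<Longrightarrow> a u v = - sinh (2 * \<tau> * (sinh \<theta>)\<^sup>2 * u + \<eta> v) / sinh \<theta>"
    and b: "\<And>u v. (u, v) \<in> U \<Longrightarrow> b u v = cosh (2 * \<tau> * (sinh \<theta>)\<^sup>2 * u + \<eta> v)"
    and du: "\<And>u v. (u, v) \<in> U \<Longrightarrow> frechet_derivative F (at (u, v)) (1, 0) = T (u, v)"
    and dv: "\<And>u v. (u, v) \<in> U \<Longrightarrow>
           frechet_derivative F (at (u, v)) (0, 1)
           = a u v *\<^sub>R T (u, v) + b u v *\<^sub>R rotation_J \<tau> (F (u, v)) (N (u, v)) (T (u, v))"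
  shows "\<exists>c f1 f2 f3.
           smooth_on (snd ` U) f1 \<and> smooth_on (snd ` U) f2 \<and> smooth_on (snd ` U) f3 \<and>
           (\<forall>(u, v)\<in>U.
              \<phi> (u, v) = - 2 * \<tau> * (sinh \<theta>)\<^sup>2 * u + c \<and>
              F (u, v) = vector
                [coth \<theta> / (2 * \<tau>) * cosh (\<phi> (u, v)) + f1 v,
                 coth \<theta> / (2 * \<tau>) * sinh (\<phi> (u, v)) + f2 v,
                 (cosh \<theta>)\<^sup>2 / 2 * u
                   - coth \<theta> / 2 * (f2 v * cosh (\<phi> (u, v)) - f1 v * sinh (\<phi> (u, v))) + f3 v]) \<and>
           (\<forall>v\<in>snd ` U.
              (deriv f1 v)\<^sup>2 - (deriv f2 v)\<^sup>2 = (cosh \<theta>)\<^sup>2 \<and>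
              deriv f3 v = \<tau> * (f1 v * deriv f2 v - f2 v * deriv f1 v))"
proof -
  define S C where "S = sinh \<theta>" and "C = cosh \<theta>"
  define k where "k = 2 * \<tau> * S\<^sup>2"
  have S: "S \<noteq> 0" and C: "C \<noteq> 0"
    using theta by (auto simp: S_def C_def)
  have coth: "coth \<theta> = C / S" by (simp add: coth_def C_def S_def)
  have U: "open U" "connected U" and smooth_F: "smooth_on U F"
    using helix by (auto simp: helix_surface_def oriented_surface_def)
  have I: "open (snd ` U)" by (rule open_image_snd[OF U(1)])
  note DF = smooth_on_has_derivative[OF smooth_F]
  have DFi: "((\<lambda>q. F q $ i) has_derivative
      (\<lambda>w. T (u, v) $ i * fst w
        + (a u v * T (u, v) $ i + b u v * rotation_J \<tau> (F (u, v)) (N (u, v)) (T (u, v)) $ i) * snd w))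
      (at (u, v))" if uv: "(u, v) \<in> U" for u v i
  proof -
    interpret bounded_linear "frechet_derivative F (at (u, v))"
      using DF[OF uv] by (rule has_derivative_bounded_linear)
    have "frechet_derivative F (at (u, v)) w = fst w *\<^sub>R T (u, v)
        + snd w *\<^sub>R (a u v *\<^sub>R T (u, v) + b u v *\<^sub>R rotation_J \<tau> (F (u, v)) (N (u, v)) (T (u, v)))" for w
    proof -
      have "w = fst w *\<^sub>R (1, 0) + snd w *\<^sub>R (0, 1)" by (simp add: prod_eq_iff)
      then show ?thesis by (metis add scaleR du[OF uv] dv[OF uv])
    qed
    moreover have "((\<lambda>q. F q $ i) has_derivative (\<lambda>w. frechet_derivative F (at (u, v)) w $ i)) (at (u, v))"
      by (rule bounded_linear.has_derivative[OF bounded_linear_vec_nth DF[OF uv]])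
    ultimately show ?thesis by (simp add: algebra_simps)
  qed
  have frame: "T (u, v) = C\<^sup>2 *\<^sub>R heis_E3
      - (S * C) *\<^sub>R (sinh (\<phi> (u, v)) *\<^sub>R heis_E1 \<tau> (F (u, v)) + cosh (\<phi> (u, v)) *\<^sub>R heis_E2 \<tau> (F (u, v)))"
    "rotation_J \<tau> (F (u, v)) (N (u, v)) (T (u, v))
      = C *\<^sub>R (cosh (\<phi> (u, v)) *\<^sub>R heis_E1 \<tau> (F (u, v)) + sinh (\<phi> (u, v)) *\<^sub>R heis_E2 \<tau> (F (u, v)))"
    if "(u, v) \<in> U" for u v
    using helix_tangent_frame[of \<tau> "F (u, v)" \<theta> "\<phi> (u, v)"]
    by (simp_all only: T[OF that] normal[OF that] S_def C_def)
  have ab: "a u v = - sinh (k * u + \<eta> v) / S" "b u v = cosh (k * u + \<eta> v)" if "(u, v) \<in> U" for u v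
    using a[OF that] b[OF that] by (simp_all add: k_def S_def)
  \<comment> \<open>The addition theorems turn the coefficients \<open>a\<close> and \<open>b\<close> into a shift of the hyperbolic angle: the
    \<open>v\<close>-derivatives of the first two coordinates depend on \<open>\<phi>\<close> only through \<open>k u + \<eta> v + \<phi>\<close>.\<close>
  have D1: "((\<lambda>q. F q $ 1) has_derivative
      (\<lambda>w. - (S * C) * sinh (\<phi> (u, v)) * fst w + C * cosh (k * u + \<eta> v + \<phi> (u, v)) * snd w)) (at (u, v))"
    if uv: "(u, v) \<in> U" for u v
    using DFi[OF uv, of 1] unfolding frame(2)[OF uv] unfolding frame(1)[OF uv] ab[OF uv]
      cosh_add[of "k * u + \<eta> v"] sinh_add[of "k * u + \<eta> v"]
    by (rule has_derivative_eq_rhs)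
      (use S in \<open>simp add: heis_frame_defs fun_eq_iff algebra_simps\<close>)
  have D2: "((\<lambda>q. F q $ 2) has_derivative
      (\<lambda>w. - (S * C) * cosh (\<phi> (u, v)) * fst w + C * sinh (k * u + \<eta> v + \<phi> (u, v)) * snd w)) (at (u, v))"
    if uv: "(u, v) \<in> U" for u v
    using DFi[OF uv, of 2] unfolding frame(2)[OF uv] unfolding frame(1)[OF uv] ab[OF uv]
      cosh_add[of "k * u + \<eta> v"] sinh_add[of "k * u + \<eta> v"]
    by (rule has_derivative_eq_rhs)
      (use S in \<open>simp add: heis_frame_defs fun_eq_iff algebra_simps\<close>)
  have D3: "((\<lambda>q. F q $ 3) has_derivative
      (\<lambda>w. (C\<^sup>2 + \<tau> * (S * C) * (F (u, v) $ 2 * sinh (\<phi> (u, v)) - F (u, v) $ 1 * cosh (\<phi> (u, v)))) * fst w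
        + (- sinh (k * u + \<eta> v) * C\<^sup>2 / S
           + \<tau> * C * (F (u, v) $ 1 * sinh (k * u + \<eta> v + \<phi> (u, v))
                       - F (u, v) $ 2 * cosh (k * u + \<eta> v + \<phi> (u, v)))) * snd w)) (at (u, v))"
    if uv: "(u, v) \<in> U" for u v
    using DFi[OF uv, of 3] unfolding frame(2)[OF uv] unfolding frame(1)[OF uv] ab[OF uv]
      cosh_add[of "k * u + \<eta> v"] sinh_add[of "k * u + \<eta> v"]
    by (rule has_derivative_eq_rhs)
      (use S in \<open>simp add: heis_frame_defs fun_eq_iff field_simps\<close>)
  have "- (S * C) \<noteq> 0" using S C by simp
  from rotation_angle_affine[OF U phi eta this C D1 D2]
  obtain c where c: "\<And>u v. (u, v) \<in> U \<Longrightarrow> \<phi> (u, v) = - k * u + c" by blast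

  define g1 g2 where "g1 = (\<lambda>v. C * cosh (\<eta> v + c))" and "g2 = (\<lambda>v. C * sinh (\<eta> v + c))"
  have smooth_g: "smooth_on (snd ` U) g1" "smooth_on (snd ` U) g2"
    unfolding g1_def g2_def
    by (intro smooth_on_mult smooth_on_cosh smooth_on_sinh smooth_on_add smooth_on_const I eta)+
  \<comment> \<open>This cancellation of \<open>u\<close> is what makes the \<open>v\<close>-derivatives functions of \<open>v\<close> alone.\<close>
  have sum: "k * u + \<eta> v + \<phi> (u, v) = \<eta> v + c" if "(u, v) \<in> U" for u v
    using c[OF that] by simp
  have K: "C / (2 * \<tau> * S) * k = S * C"
    using tau S by (simp add: k_def power2_eq_square)
  have d_affine: "((\<lambda>q::real \<times> real. - k * fst q + c) has_derivative (\<lambda>w. - k * fst w)) (at z)" for z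
    by (auto intro!: derivative_eq_intros)
  have d_cosh: "((\<lambda>q::real \<times> real. cosh (- k * fst q + c)) has_derivative
      (\<lambda>w. - k * fst w * sinh (- k * u + c))) (at (u, v))"
    and d_sinh: "((\<lambda>q::real \<times> real. sinh (- k * fst q + c)) has_derivative
      (\<lambda>w. - k * fst w * cosh (- k * u + c))) (at (u, v))" for u v
    using DERIV_compose_FDERIV[OF has_field_derivative_cosh[OF DERIV_ident] d_affine[of "(u, v)"]]
      DERIV_compose_FDERIV[OF has_field_derivative_sinh[OF DERIV_ident] d_affine[of "(u, v)"]]
    by simp_all
  have "((\<lambda>q. F q $ 1 - C / (2 * \<tau> * S) * cosh (- k * fst q + c)) has_derivative
      (\<lambda>w. g1 (snd z) * snd w)) (at z)" if "z \<in> U" for z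
  proof -
    obtain u v where z: "z = (u, v)" by (cases z)
    with that have uv: "(u, v) \<in> U" by simp
    have "((\<lambda>q. C / (2 * \<tau> * S) * cosh (- k * fst q + c)) has_derivative
      (\<lambda>w. - (S * C) * sinh (\<phi> (u, v)) * fst w)) (at (u, v))"
      unfolding K[symmetric] c[OF uv]
      by (rule has_derivative_eq_rhs[OF has_derivative_mult_right[OF d_cosh]]) (simp add: fun_eq_iff)
    from has_derivative_diff[OF D1[OF uv] this] show ?thesis
      unfolding z sum[OF uv] by (simp add: g1_def)
  qed
  from function_of_second_coordinate[OF U smooth_g(1) this]
  obtain f1 where f1: "smooth_on (snd ` U) f1"
      "\<And>v. v \<in> snd ` U \<Longrightarrow> (f1 has_real_derivative g1 v) (at v)"
      "\<And>u v. (u, v) \<in> U \<Longrightarrow> F (u, v) $ 1 - C / (2 * \<tau> * S) * cosh (- k * u + c) = f1 v"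
    by (metis fst_conv)
  have "((\<lambda>q. F q $ 2 - C / (2 * \<tau> * S) * sinh (- k * fst q + c)) has_derivative
      (\<lambda>w. g2 (snd z) * snd w)) (at z)" if "z \<in> U" for z
  proof -
    obtain u v where z: "z = (u, v)" by (cases z)
    with that have uv: "(u, v) \<in> U" by simp
    have "((\<lambda>q. C / (2 * \<tau> * S) * sinh (- k * fst q + c)) has_derivative
      (\<lambda>w. - (S * C) * cosh (\<phi> (u, v)) * fst w)) (at (u, v))"
      unfolding K[symmetric] c[OF uv]
      by (rule has_derivative_eq_rhs[OF has_derivative_mult_right[OF d_sinh]]) (simp add: fun_eq_iff)
    from has_derivative_diff[OF D2[OF uv] this] show ?thesis
      unfolding z sum[OF uv] by (simp add: g2_def)
  qed
  from function_of_second_coordinate[OF U smooth_g(2) this]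
  obtain f2 where f2: "smooth_on (snd ` U) f2"
      "\<And>v. v \<in> snd ` U \<Longrightarrow> (f2 has_real_derivative g2 v) (at v)"
      "\<And>u v. (u, v) \<in> U \<Longrightarrow> F (u, v) $ 2 - C / (2 * \<tau> * S) * sinh (- k * u + c) = f2 v"
    by (metis fst_conv)

  \<comment> \<open>\<open>- f2 g1\<close> is written with a factor \<open>- 1\<close> so that closure of smoothness under products and sums applies.\<close>
  define g3 where "g3 = (\<lambda>v. \<tau> * (f1 v * g2 v + (- 1) * (f2 v * g1 v)))"
  have smooth_g3: "smooth_on (snd ` U) g3"
    unfolding g3_def by (intro smooth_on_mult smooth_on_add smooth_on_const I f1(1) f2(1) smooth_g)
  have "((\<lambda>q. F q $ 3 - (C\<^sup>2 / 2 * fst q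
       - C / (2 * S) * (f2 (snd q) * cosh (- k * fst q + c) - f1 (snd q) * sinh (- k * fst q + c))))
     has_derivative (\<lambda>w. g3 (snd z) * snd w)) (at z)" if "z \<in> U" for z
  proof -
    obtain u v where z: "z = (u, v)" by (cases z)
    with that have uv: "(u, v) \<in> U" by simp
    then have v: "v \<in> snd ` U" by force
    define s ch where "s = sinh (\<phi> (u, v))" and "ch = cosh (\<phi> (u, v))"
    have ch: "ch\<^sup>2 = 1 + s\<^sup>2" by (simp add: s_def ch_def cosh_square_eq)
    have F12: "F (u, v) $ 1 = C / (2 * \<tau> * S) * ch + f1 v" "F (u, v) $ 2 = C / (2 * \<tau> * S) * s + f2 v"
      using f1(3)[OF uv] f2(3)[OF uv] by (simp_all add: s_def ch_def c[OF uv])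
    have df1: "((\<lambda>q. f1 (snd q)) has_derivative (\<lambda>w. snd w * g1 v)) (at (u, v))"
      using DERIV_compose_FDERIV[where f = f1 and g = snd and x = "(u, v)" and g' = snd] f1(2)[OF v]
      by (simp add: has_derivative_snd)
    have df2: "((\<lambda>q. f2 (snd q)) has_derivative (\<lambda>w. snd w * g2 v)) (at (u, v))"
      using DERIV_compose_FDERIV[where f = f2 and g = snd and x = "(u, v)" and g' = snd] f2(2)[OF v]
      by (simp add: has_derivative_snd)
    have "((\<lambda>q. C\<^sup>2 / 2 * fst q
       - C / (2 * S) * (f2 (snd q) * cosh (- k * fst q + c) - f1 (snd q) * sinh (- k * fst q + c)))
      has_derivative (\<lambda>w. (C\<^sup>2 / 2 + C / (2 * S) * k * (f2 v * s - f1 v * ch)) * fst w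
         - C / (2 * S) * (g2 v * ch - g1 v * s) * snd w)) (at (u, v))"
      by (rule has_derivative_eq_rhs[OF has_derivative_diff[
            OF has_derivative_mult_right[OF has_derivative_fst[OF has_derivative_ident]]
               has_derivative_mult_right[OF has_derivative_diff[
                 OF has_derivative_mult[OF df2 d_cosh] has_derivative_mult[OF df1 d_sinh]]]]])
        (simp add: s_def ch_def c[OF uv] fun_eq_iff algebra_simps)
    note D = has_derivative_diff[OF D3[OF uv] this]
    \<comment> \<open>The quadratic terms contribute \<open>s\<^sup>2 - ch\<^sup>2 = - 1\<close>, which halves the coefficient \<open>C\<^sup>2\<close> of \<open>u\<close>.\<close>
    have du_coeff: "C\<^sup>2 + \<tau> * (S * C) * (F (u, v) $ 2 * s - F (u, v) $ 1 * ch)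
        = C\<^sup>2 / 2 + C / (2 * S) * k * (f2 v * s - f1 v * ch)" (is "?P = ?P'")
    proof -
      have "?P = C\<^sup>2 + C\<^sup>2 / 2 * (s\<^sup>2 - ch\<^sup>2) + \<tau> * (S * C) * (f2 v * s - f1 v * ch)"
        unfolding F12 using tau S by (simp add: field_simps power2_eq_square)
      also have "\<dots> = ?P'"
        unfolding ch k_def using S by (simp add: field_simps power2_eq_square)
      finally show ?thesis .
    qed
    \<comment> \<open>\<open>sinh (k u + \<eta> v)\<close> is expanded at the difference \<open>(\<eta> v + c) - \<phi>\<close>.  The cosh and sinh parts of the
      first two coordinates then cancel half of the term from \<open>a\<close>; the other half is the \<open>v\<close>-derivative of
      the term with \<open>f2\<close> and \<open>f1\<close> that is subtracted from \<open>F $ 3\<close>.\<close>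
    have dv_coeff: "- sinh (k * u + \<eta> v) * C\<^sup>2 / S
        + \<tau> * C * (F (u, v) $ 1 * sinh (\<eta> v + c) - F (u, v) $ 2 * cosh (\<eta> v + c))
        = g3 v - C / (2 * S) * (g2 v * ch - g1 v * s)" (is "?Q = ?Q'")
    proof -
      have "sinh (k * u + \<eta> v) = sinh ((\<eta> v + c) - \<phi> (u, v))"
        using sum[OF uv] by (simp add: algebra_simps)
      also have "\<dots> = sinh (\<eta> v + c) * ch - cosh (\<eta> v + c) * s"
        by (simp add: sinh_diff s_def ch_def)
      finally have sinh_eq: "sinh (k * u + \<eta> v) = sinh (\<eta> v + c) * ch - cosh (\<eta> v + c) * s" .
      show ?thesis
        unfolding sinh_eq F12 g3_def g1_def g2_def
        using tau S by (simp add: field_simps power2_eq_square)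
    qed
    show ?thesis
      using D unfolding z sum[OF uv] s_def[symmetric] ch_def[symmetric] du_coeff dv_coeff
      by (rule has_derivative_eq_rhs) (simp add: fun_eq_iff algebra_simps)
  qed
  from function_of_second_coordinate[OF U smooth_g3 this]
  obtain f3 where f3: "smooth_on (snd ` U) f3"
      "\<And>v. v \<in> snd ` U \<Longrightarrow> (f3 has_real_derivative g3 v) (at v)"
      "\<And>u v. (u, v) \<in> U \<Longrightarrow> F (u, v) $ 3 - (C\<^sup>2 / 2 * u
       - C / (2 * S) * (f2 v * cosh (- k * u + c) - f1 v * sinh (- k * u + c))) = f3 v"
    by (metis fst_conv snd_conv)

  have position: "\<phi> (u, v) = - 2 * \<tau> * (sinh \<theta>)\<^sup>2 * u + c \<and>
      F (u, v) = vector
        [coth \<theta> / (2 * \<tau>) * cosh (\<phi> (u, v)) + f1 v,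
         coth \<theta> / (2 * \<tau>) * sinh (\<phi> (u, v)) + f2 v,
         (cosh \<theta>)\<^sup>2 / 2 * u
           - coth \<theta> / 2 * (f2 v * cosh (\<phi> (u, v)) - f1 v * sinh (\<phi> (u, v))) + f3 v]"
    if uv: "(u, v) \<in> U" for u v
  proof -
    have "F (u, v) $ 1 = C / S / (2 * \<tau>) * cosh (\<phi> (u, v)) + f1 v"
      "F (u, v) $ 2 = C / S / (2 * \<tau>) * sinh (\<phi> (u, v)) + f2 v"
      using f1(3)[OF uv] f2(3)[OF uv] unfolding c[OF uv] by (simp_all add: diff_eq_eq mult_ac)
    moreover have "F (u, v) $ 3 = C\<^sup>2 / 2 * u
        - C / S / 2 * (f2 v * cosh (\<phi> (u, v)) - f1 v * sinh (\<phi> (u, v))) + f3 v"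
      using f3(3)[OF uv] unfolding c[OF uv] diff_eq_eq by (simp add: mult.commute[of 2])
    moreover have "\<phi> (u, v) = - 2 * \<tau> * (sinh \<theta>)\<^sup>2 * u + c"
      using c[OF uv] by (simp add: k_def S_def)
    ultimately show ?thesis
      unfolding coth C_def[symmetric] by (simp add: vec_eq_iff forall_3)
  qed
  have "(deriv f1 v)\<^sup>2 - (deriv f2 v)\<^sup>2 = (cosh \<theta>)\<^sup>2 \<and>
      deriv f3 v = \<tau> * (f1 v * deriv f2 v - f2 v * deriv f1 v)" if v: "v \<in> snd ` U" for v
  proof -
    have "deriv f1 v = g1 v" "deriv f2 v = g2 v" "deriv f3 v = g3 v"
      using f1(2)[OF v] f2(2)[OF v] f3(2)[OF v] by (simp_all add: DERIV_imp_deriv)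
    moreover have "(g1 v)\<^sup>2 - (g2 v)\<^sup>2 = C\<^sup>2"
      by (simp add: g1_def g2_def power_mult_distrib cosh_square_eq algebra_simps)
    ultimately show ?thesis by (simp add: g3_def C_def)
  qed
  with position f1(1) f2(1) f3(1) show ?thesis by blast
qed

end
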